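(* Assume the $abc$-conjecture: for every $\delta > 0$ there is a constant $K_\delta$ such that for all triples $(A,B,C)$ of pairwise co-prime positive integers with $A + B = C$ one has $C < K_\delta\, \kappa(ABC)^{1+\delta}$, where $\kappa(n) = \prod_{p \mid n} p$ (product over the distinct primes dividing $n$) is the squarefree kernel of $n$. Let $l$ be a non-zero integer and let $\epsilon$ be a real number with $0 < \epsilon < 2/5$. Then there exists a constant $C_{\epsilon,l} > 0$, depending only on $\epsilon$ and $l$, such that whenever $a, b$ are positive integers with $1 \le a < b$ and \[ a^2(a^2+l) \mid b^2(b^2+l), \] we have \[ b \ge C_{\epsilon,l}\, a^{8/7 - \epsilon}. \] *)

theory Defs
  imports Complex_Main "HOL-Computational_Algebra.Primes"
begin

definition squarefree_kernel :: "nat \<Rightarrow> nat" where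
  "squarefree_kernel n = (\<Prod>p \<in> prime_factors n. p)"

definition abc_conjecture :: bool where
  "abc_conjecture \<longleftrightarrow>
     (\<forall>\<delta>::real. \<delta> > 0 \<longrightarrow>
       (\<exists>K::real. \<forall>A B C :: nat.
          A > 0 \<longrightarrow> B > 0 \<longrightarrow> C > 0 \<longrightarrow>
          coprime A B \<longrightarrow> coprime A C \<longrightarrow> coprime B C \<longrightarrow> A + B = C \<longrightarrow>
          real C < K * real (squarefree_kernel (A * B * C)) powr (1 + \<delta>)))"

end

theory Submission
  imports Defs
begin

text \<open>
  Write \<open>d = gcd a b\<close>, \<open>a = d u\<close>, \<open>b = d c\<close>. The divisibility yields \<open>a\<^sup>2 + l = V m\<close> and
  \<open>b\<^sup>2 + l = u\<^sup>2 m s\<close> with \<open>V\<close> a divisor of \<open>c\<^sup>2\<close>. Then \<open>P = c\<^sup>2 V - s u\<^sup>4\<close> satisfies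
  \<open>m P = l (c\<^sup>2 - u\<^sup>2)\<close>, so \<open>P\<close> is non-zero and small, while the primes dividing
  \<open>c\<^sup>2 V\<close>, \<open>s u\<^sup>4\<close> and \<open>P\<close> all divide \<open>c s u P\<close>, and the greatest common divisor of \<open>c\<^sup>2 V\<close> and
  \<open>s u\<^sup>4\<close> divides \<open>l\<^sup>2\<close>. Up to small powers of \<open>b\<close>, the abc-conjecture therefore bounds
  \<open>u\<^sup>3 m\<close> by a multiple of \<open>c\<^sup>3\<close>. As \<open>u\<^sup>2\<close> and \<open>V\<close> are coprime divisors of
  \<open>a\<^sup>2 + b\<^sup>2 + l\<close>, also \<open>u\<^sup>2 V\<close> is at most a multiple of \<open>b\<^sup>2\<close>. Together with \<open>V \<le> c\<^sup>2\<close> these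
  bounds give \<open>a\<^sup>1\<^sup>2 \<le> M b\<^bsup>10 + 10 \<delta>\<^esup>\<close>, and \<open>\<delta> = 1/20\<close> turns this into the exponent \<open>8/7\<close>.
\<close>

section \<open>The abc-conjecture for summands with a common factor\<close>

lemma squarefree_kernel_dvd:
  assumes "m > 0" and "\<And>p. prime p \<Longrightarrow> p dvd n \<Longrightarrow> p dvd m"
  shows "squarefree_kernel n dvd m"
proof -
  have "(\<Prod>p\<in>A. p) dvd m" if "finite A" "A \<subseteq> prime_factors n" for A
    using that
  proof (induction A rule: finite_induct)
    case (insert q A)
    have q: "prime q" "q dvd m"
      using insert.prems assms(2) by auto
    have "coprime q (\<Prod>p\<in>A. p)"
      using insert.prems insert.hyps q(1)
      by (intro prod_coprime_right) (auto intro!: primes_coprime)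
    then show ?case
      using insert q(2) by (simp add: divides_mult)
  qed simp
  then show ?thesis
    unfolding squarefree_kernel_def by simp
qed

text \<open>Dividing \<open>x\<close> and \<open>y\<close> by their gcd makes the triple coprime,
  and multiplying back costs exactly one factor \<open>gcd x y\<close>. The kernel is replaced by
  any \<open>N\<close> divisible by the relevant primes, so applications only have to track prime
  divisors.\<close>

lemma abc_conjecture_gcd:
  fixes \<delta> :: real
  assumes "abc_conjecture" and "\<delta> > 0"
  obtains K :: real where "K > 0"
    and "\<And>x y N :: nat. x > 0 \<Longrightarrow> y > 0 \<Longrightarrow> N > 0 \<Longrightarrow>
           (\<And>p. prime p \<Longrightarrow> p dvd x * y * (x + y) \<Longrightarrow> p dvd N) \<Longrightarrow>
           real (x + y) \<le> K * real (gcd x y) * real N powr (1 + \<delta>)"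
proof -
  obtain K0 :: real where K0: "\<And>A B C :: nat. A > 0 \<Longrightarrow> B > 0 \<Longrightarrow> C > 0 \<Longrightarrow>
      coprime A B \<Longrightarrow> coprime A C \<Longrightarrow> coprime B C \<Longrightarrow> A + B = C \<Longrightarrow>
      real C < K0 * real (squarefree_kernel (A * B * C)) powr (1 + \<delta>)"
    using assms unfolding abc_conjecture_def by meson
  \<comment> \<open>The conjecture as stated gives no sign for \<open>K0\<close>; a positive
    constant is needed for the monotonicity steps.\<close>
  define K where "K = \<bar>K0\<bar> + 1"
  show thesis
  proof (rule that)
    show "K > 0" by (simp add: K_def)
    fix x y N :: nat
    assume pos: "x > 0" "y > 0" "N > 0"
      and primes: "\<And>p. prime p \<Longrightarrow> p dvd x * y * (x + y) \<Longrightarrow> p dvd N"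
    define g where "g = gcd x y"
    obtain A B where AB: "x = A * g" "y = B * g" "coprime A B"
      using gcd_coprime_exists[of x y] pos unfolding g_def by (metis gcd_eq_0_iff less_numeral_extra(3))
    have AB_pos: "A > 0" "B > 0" "g > 0"
      using pos AB by auto
    have "A * B * (A + B) dvd x * y * (x + y)"
      unfolding AB by (rule dvdI[of _ _ "g ^ 3"]) (simp add: algebra_simps power3_eq_cube)
    then have "squarefree_kernel (A * B * (A + B)) dvd N"
      using pos primes by (intro squarefree_kernel_dvd) (auto intro: dvd_trans)
    then have ker: "squarefree_kernel (A * B * (A + B)) \<le> N"
      using pos by (intro dvd_imp_le)
    have "coprime A (A + B)" "coprime B (A + B)"
      using AB(3) by (metis coprime_iff_gcd_eq_1 gcd_add2, metis coprime_iff_gcd_eq_1 gcd.commute gcd_add1)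
    then have "real (A + B) \<le> K0 * real (squarefree_kernel (A * B * (A + B))) powr (1 + \<delta>)"
      using AB(3) AB_pos by (intro less_imp_le K0) auto
    also have "\<dots> \<le> K * real N powr (1 + \<delta>)"
      using ker assms(2) unfolding K_def by (intro mult_mono powr_mono2) auto
    finally have "real g * real (A + B) \<le> real g * (K * real N powr (1 + \<delta>))"
      by (intro mult_left_mono) auto
    then show "real (x + y) \<le> K * real (gcd x y) * real N powr (1 + \<delta>)"
      unfolding g_def[symmetric] by (simp add: AB algebra_simps)
  qed
qed

section \<open>Arithmetic consequences of the divisibility\<close>

lemma dvd_factorization:
  fixes a b l :: int
  assumes "a > 0" "b > 0" "a\<^sup>2 + l > 0" "b\<^sup>2 + l > 0"
    and dvd: "a\<^sup>2 * (a\<^sup>2 + l) dvd b\<^sup>2 * (b\<^sup>2 + l)"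
  obtains d u c V m s :: int
  where "a = d * u" "b = d * c" "coprime u c" "V dvd c\<^sup>2"
    and "a\<^sup>2 + l = V * m" "b\<^sup>2 + l = u\<^sup>2 * m * s"
    and "d > 0" "u > 0" "c > 0" "V > 0" "m > 0" "s > 0"
proof -
  define d where "d = gcd a b"
  have d: "d > 0" using assms by (simp add: d_def)
  obtain u c where uc: "a = u * d" "b = c * d" "coprime u c"
    using gcd_coprime_exists[of a b] d unfolding d_def by auto
  have uc_pos: "u > 0" "c > 0"
    using assms(1,2) d uc by (auto simp: zero_less_mult_iff)
  \<comment> \<open>\<open>V\<close> is the part of \<open>a^2 + l\<close> that \<open>c^2\<close>
    can absorb. The rest \<open>m\<close> is coprime to \<open>R\<close>, the cofactor of
    \<open>V\<close> in \<open>c^2\<close>, so it must divide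
    \<open>(b^2 + l) / u^2\<close>.\<close>
  define V where "V = gcd (a\<^sup>2 + l) (c\<^sup>2)"
  have V: "V > 0" using uc_pos by (simp add: V_def)
  obtain m R where mR: "a\<^sup>2 + l = m * V" "c\<^sup>2 = R * V" "coprime m R"
    using gcd_coprime_exists[of "a\<^sup>2 + l" "c\<^sup>2"] V unfolding V_def by auto
  have m: "m > 0" using assms(3) V mR by (simp add: zero_less_mult_iff)
  have "d\<^sup>2 * (u\<^sup>2 * (a\<^sup>2 + l)) dvd d\<^sup>2 * (c\<^sup>2 * (b\<^sup>2 + l))"
    using dvd by (simp add: uc algebra_simps power_mult_distrib)
  then have *: "u\<^sup>2 * (a\<^sup>2 + l) dvd c\<^sup>2 * (b\<^sup>2 + l)"
    using d by simp
  then have "u\<^sup>2 dvd c\<^sup>2 * (b\<^sup>2 + l)"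
    by (rule dvd_mult_left)
  then have "u\<^sup>2 dvd b\<^sup>2 + l"
    using uc(3) by (simp add: coprime_dvd_mult_right_iff)
  then obtain t where t: "b\<^sup>2 + l = u\<^sup>2 * t" by (rule dvdE)
  have "(u\<^sup>2 * V) * m dvd (u\<^sup>2 * V) * (R * t)"
    using * unfolding t mR by (simp add: algebra_simps)
  then have "m dvd R * t"
    using uc_pos V by simp
  then have "m dvd t"
    using mR(3) by (simp add: coprime_dvd_mult_right_iff)
  then obtain s where s: "t = m * s" by (rule dvdE)
  have "s > 0" using assms(4) m uc_pos unfolding t s by (simp add: zero_less_mult_iff)
  then show thesis
    using that[of d u c V m s] d uc uc_pos V m mR t s by (simp add: mult_ac)
qed

text \<open>The condition \<open>2 * \<bar>l\<bar> \<le> a\<^sup>2\<close> makes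
  \<open>a^2 + l\<close> and \<open>b^2 + l\<close> positive and comparable to \<open>a^2\<close>
  and \<open>b^2\<close>. The term \<open>10 * \<delta>\<close> arises because \<open>N\<close> is
  at most a constant times \<open>b^5\<close> and the abc estimate is used squared.\<close>

lemma dvd_gap_bound:
  fixes l :: int and \<delta> :: real
  assumes "abc_conjecture" and "l \<noteq> 0" and "\<delta> > 0"
  obtains M :: real where "M > 0"
    and "\<And>a b :: int. 0 < a \<Longrightarrow> a < b \<Longrightarrow> 2 * \<bar>l\<bar> \<le> a\<^sup>2 \<Longrightarrow>
           a\<^sup>2 * (a\<^sup>2 + l) dvd b\<^sup>2 * (b\<^sup>2 + l) \<Longrightarrow>
           real_of_int a ^ 12 \<le> M * real_of_int b powr (10 + 10 * \<delta>)"
proof -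
  obtain K :: real where K: "K > 0"
    and abc: "\<And>x y N :: nat. x > 0 \<Longrightarrow> y > 0 \<Longrightarrow> N > 0 \<Longrightarrow>
           (\<And>p. prime p \<Longrightarrow> p dvd x * y * (x + y) \<Longrightarrow> p dvd N) \<Longrightarrow>
           real (x + y) \<le> K * real (gcd x y) * real N powr (1 + \<delta>)"
    using abc_conjecture_gcd[OF assms(1,3)] by blast
  define L where "L = real_of_int \<bar>l\<bar>"
  have L: "L \<ge> 1" using assms(2) by (simp add: L_def)
  \<comment> \<open>The factors come, in order, from abc, from the gcd bound, from
    \<open>N powr \<delta>\<close>, and from the bound on \<open>m * \<bar>P\<bar>\<close>.\<close>
  define H where "H = K * L\<^sup>2 * (2 * L) powr \<delta> * L"
  have H: "H > 0" using K L by (simp add: H_def)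
  show thesis
  proof (rule that[of "12 * H\<^sup>2"])
    show "12 * H\<^sup>2 > 0" using H by simp
    fix a b :: int
    assume a: "0 < a" and ab: "a < b" and la: "2 * \<bar>l\<bar> \<le> a\<^sup>2"
      and dvd: "a\<^sup>2 * (a\<^sup>2 + l) dvd b\<^sup>2 * (b\<^sup>2 + l)"
    have ab2: "a\<^sup>2 < b\<^sup>2" using a ab by (intro power_strict_mono) auto
    have a2l: "a\<^sup>2 \<le> 2 * (a\<^sup>2 + l)" "0 < a\<^sup>2 + l" and b2l: "b\<^sup>2 + l \<le> 2 * b\<^sup>2" "0 < b\<^sup>2 + l"
      using la ab2 assms(2) by (auto simp: abs_if split: if_splits)
    obtain d u c V m s :: int
      where f: "a = d * u" "b = d * c" "coprime u c" "V dvd c\<^sup>2"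
        "a\<^sup>2 + l = V * m" "b\<^sup>2 + l = u\<^sup>2 * m * s"
        and pos: "d > 0" "u > 0" "c > 0" "V > 0" "m > 0" "s > 0"
      using dvd_factorization[OF a less_trans[OF a ab] a2l(2) b2l(2) dvd] by blast
    have uc: "u < c" using ab f pos by simp
    \<comment> \<open>Multiplied by \<open>m\<close>, this is
      \<open>c^2 * (a^2 + l) - u^2 * (b^2 + l)\<close>, where the terms \<open>c^2 * a^2\<close> and
      \<open>u^2 * b^2\<close> cancel.\<close>
    define P where "P = c\<^sup>2 * V - s * u ^ 4"
    have "m * P = c\<^sup>2 * (V * m) - u\<^sup>2 * (u\<^sup>2 * m * s)"
      by (simp add: P_def algebra_simps power2_eq_square power4_eq_xxxx)
    also have "\<dots> = l * (c\<^sup>2 - u\<^sup>2)"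
      unfolding f(5,6)[symmetric] unfolding f(1,2) by (simp add: algebra_simps power_mult_distrib)
    finally have mP: "m * P = l * (c\<^sup>2 - u\<^sup>2)" .
    have cu2: "u\<^sup>2 < c\<^sup>2" using pos uc by (intro power_strict_mono) auto
    then have P0: "P \<noteq> 0" using mP assms(2) by auto
    have "m * \<bar>P\<bar> = \<bar>l\<bar> * (c\<^sup>2 - u\<^sup>2)"
      using arg_cong[OF mP, of abs] pos cu2 abs_of_pos[of "c\<^sup>2 - u\<^sup>2"] by (simp add: abs_mult)
    also have "\<dots> \<le> \<bar>l\<bar> * c\<^sup>2" by (intro mult_left_mono) auto
    finally have mP_le: "m * \<bar>P\<bar> \<le> \<bar>l\<bar> * c\<^sup>2" .
    \<comment> \<open>The gcd divides \<open>c^4\<close>, so it is coprime to \<open>u\<close> and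
      divides \<open>s\<close>, hence \<open>b^2 + l\<close>. It also divides \<open>b^4\<close>,
      which is congruent to \<open>l^2\<close> modulo \<open>b^2 + l\<close>.\<close>
    have gcd_dvd: "gcd (c\<^sup>2 * V) (s * u ^ 4) dvd l\<^sup>2"
    proof -
      let ?g = "gcd (c\<^sup>2 * V) (s * u ^ 4)"
      have "c\<^sup>2 * V dvd c\<^sup>2 * c\<^sup>2" using f(4) by (rule mult_dvd_mono[OF dvd_refl])
      then have gc: "?g dvd c ^ 4"
        using dvd_trans[OF gcd_dvd1] by (metis numeral_Bit0 power_add)
      have "coprime (c ^ 4) (u ^ 4)" using f(3) by (simp add: coprime_commute)
      then have "coprime ?g (u ^ 4)" by (rule coprime_divisors[OF gc dvd_refl])
      then have "?g dvd s" using coprime_dvd_mult_left_iff gcd_dvd2 by blast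
      then have gb: "?g dvd b\<^sup>2 + l" unfolding f(6) by (rule dvd_mult)
      have "?g dvd b ^ 4" using gc unfolding f(2) by (simp add: power_mult_distrib)
      moreover have "b ^ 4 = (b\<^sup>2 + l) * (b\<^sup>2 - l) + l\<^sup>2"
        by (simp add: algebra_simps power2_eq_square power4_eq_xxxx)
      ultimately show ?thesis
        using dvd_mult2[OF gb, of "b\<^sup>2 - l"] dvd_add_right_iff by metis
    qed
    have "u\<^sup>2 dvd (b\<^sup>2 + l) + a\<^sup>2" unfolding f(6) by (intro dvd_add) (auto simp: f(1) power_mult_distrib)
    moreover have "V dvd (a\<^sup>2 + l) + b\<^sup>2"
      using f(4) unfolding f(5) by (intro dvd_add) (auto simp: f(2) power_mult_distrib)
    moreover have "coprime (u\<^sup>2) V"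
      using f(3,4) coprime_divisors[of "u\<^sup>2" "u\<^sup>2" V "c\<^sup>2"] by auto
    ultimately have "u\<^sup>2 * V dvd a\<^sup>2 + b\<^sup>2 + l"
      by (intro divides_mult) (auto simp: add_ac)
    then have "u\<^sup>2 * V \<le> a\<^sup>2 + b\<^sup>2 + l"
      using a2l ab2 zero_le_power2[of a] by (intro zdvd_imp_le) linarith+
    then have uV: "u\<^sup>2 * V \<le> 3 * b\<^sup>2" using ab2 b2l by simp
    \<comment> \<open>Exponents are dropped, and \<open>V\<close> is omitted because its primes
      already divide \<open>c\<close>.\<close>
    define N where "N = c * s * u * \<bar>P\<bar>"
    have N: "N > 0" using pos P0 by (simp add: N_def)
    have primes: "p dvd N" if "prime p" "p dvd (c\<^sup>2 * V) * (s * u ^ 4) * P" for p :: int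
    proof -
      have "p dvd c\<^sup>2 \<or> p dvd V \<or> p dvd s \<or> p dvd u ^ 4 \<or> p dvd P"
        using that by (auto simp: prime_dvd_mult_iff)
      then have "p dvd c \<or> p dvd s \<or> p dvd u \<or> p dvd P"
        using prime_dvd_power[OF that(1)] dvd_trans[OF _ f(4)] by blast
      then show ?thesis by (auto simp: N_def)
    qed
    \<comment> \<open>The sign of \<open>P\<close> is unknown, so the abc triple is either
      \<open>s * u ^ 4 + P = c\<^sup>2 * V\<close> or
      \<open>c\<^sup>2 * V + (- P) = s * u ^ 4\<close>. This statement serves both cases.\<close>
    have ineq: "real_of_int (s * u ^ 4) \<le> K * L\<^sup>2 * real_of_int N powr (1 + \<delta>)"
      if xy: "x > 0" "y > 0" and z: "s * u ^ 4 \<le> x + y"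
        and g: "gcd x y = gcd (c\<^sup>2 * V) (s * u ^ 4)"
        and p: "x * y * (x + y) = (c\<^sup>2 * V) * (s * u ^ 4) * \<bar>P\<bar>" for x y :: int
    proof -
      have "p dvd nat N" if "prime p" "p dvd nat x * nat y * (nat x + nat y)" for p
      proof -
        have "int p dvd int (nat x * nat y * (nat x + nat y))"
          using that(2) by (simp only: int_dvd_int_iff)
        also have "\<dots> = x * y * (x + y)"
          using xy by simp
        finally have "int p dvd x * y * (x + y)" .
        then have "int p dvd (c\<^sup>2 * V) * (s * u ^ 4) * P"
          unfolding p by (simp add: abs_if split: if_splits)
        then have "int p dvd N" using primes that(1) by simp
        then show ?thesis using N by (simp flip: int_dvd_int_iff)
      qed
      then have "real (nat x + nat y) \<le> K * real (gcd (nat x) (nat y)) * real (nat N) powr (1 + \<delta>)"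
        using xy N by (intro abc) auto
      moreover have "real (nat x + nat y) = real_of_int (x + y)" using xy by simp
      moreover have "int (gcd (nat x) (nat y)) = gcd x y"
        using xy by (simp flip: gcd_int_int_eq)
      then have "real (gcd (nat x) (nat y)) = real_of_int (gcd x y)"
        by (metis of_int_of_nat_eq)
      moreover have "real (nat N) = real_of_int N" using N by simp
      moreover have "real_of_int (gcd x y) \<le> L\<^sup>2"
      proof -
        have "gcd x y \<le> l\<^sup>2" using gcd_dvd assms(2) unfolding g by (intro zdvd_imp_le) auto
        then have "real_of_int (gcd x y) \<le> real_of_int (l\<^sup>2)" by (simp only: of_int_le_iff)
        then show ?thesis by (simp add: L_def)
      qed
      ultimately have "real_of_int (x + y) \<le> K * real_of_int (gcd x y) * real_of_int N powr (1 + \<delta>)"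
        by simp
      also have "\<dots> \<le> K * L\<^sup>2 * real_of_int N powr (1 + \<delta>)"
        using \<open>real_of_int (gcd x y) \<le> L\<^sup>2\<close> K by (intro mult_right_mono mult_left_mono) auto
      finally show ?thesis using z by (meson of_int_le_iff order_trans)
    qed
    have abc_bound: "real_of_int (s * u ^ 4) \<le> K * L\<^sup>2 * real_of_int N powr (1 + \<delta>)"
    proof (cases "P > 0")
      case True
      then have eq: "c\<^sup>2 * V = s * u ^ 4 + P" by (simp add: P_def)
      have g: "gcd (s * u ^ 4) P = gcd (c\<^sup>2 * V) (s * u ^ 4)"
        unfolding eq by (simp add: gcd.commute)
      have p: "s * u ^ 4 * P * (s * u ^ 4 + P) = (c\<^sup>2 * V) * (s * u ^ 4) * \<bar>P\<bar>"
        unfolding eq[symmetric] using True by simp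
      show ?thesis
        using True pos by (intro ineq[OF _ _ _ g p]) simp_all
    next
      case False
      then have eq: "s * u ^ 4 = c\<^sup>2 * V + (- P)" by (simp add: P_def)
      have g: "gcd (c\<^sup>2 * V) (- P) = gcd (c\<^sup>2 * V) (s * u ^ 4)"
        unfolding eq by (simp only: gcd_add2)
      have p: "c\<^sup>2 * V * (- P) * (c\<^sup>2 * V + (- P)) = (c\<^sup>2 * V) * (s * u ^ 4) * \<bar>P\<bar>"
        unfolding eq[symmetric] using False by simp
      show ?thesis
        using False P0 pos by (intro ineq[OF _ _ eq_refl[OF eq] g p]) simp_all
    qed
    have Nm_int: "N * m \<le> \<bar>l\<bar> * c ^ 3 * (s * u)"
    proof -
      have "(c * s * u) * (m * \<bar>P\<bar>) \<le> (c * s * u) * (\<bar>l\<bar> * c\<^sup>2)"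
        using mP_le pos by (intro mult_left_mono) auto
      then show ?thesis by (simp add: N_def power2_eq_square power3_eq_cube mult_ac)
    qed
    have su: "s * u \<le> 2 * b\<^sup>2"
    proof -
      have "(s * u) * 1 \<le> (s * u) * (u * m)"
        using pos by (intro mult_left_mono) (auto simp: int_one_le_iff_zero_less)
      also have "\<dots> = b\<^sup>2 + l" unfolding f(6) by (simp add: power2_eq_square)
      finally show ?thesis using b2l by simp
    qed
    have cb: "c \<le> b" using f(2) pos by simp
    \<comment> \<open>A crude bound suffices here, since it is used only under the power
      \<open>\<delta>\<close>.\<close>
    have N_le: "N \<le> 2 * \<bar>l\<bar> * b ^ 5"
    proof -
      have "N * 1 \<le> N * m" using N pos by (intro mult_left_mono) auto
      also note Nm_int
      also have "\<bar>l\<bar> * c ^ 3 * (s * u) \<le> \<bar>l\<bar> * b ^ 3 * (2 * b\<^sup>2)"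
        using cb pos a ab by (intro mult_mono[OF mult_left_mono[OF power_mono] su]) auto
      finally show ?thesis by (simp add: eval_nat_numeral mult_ac)
    qed
    define \<beta> where "\<beta> = real_of_int b powr \<delta>"
    have b_pos: "real_of_int b > 0" using a ab by simp
    have \<beta>: "\<beta> > 0" using b_pos by (simp add: \<beta>_def)
    have N_powr: "real_of_int N powr \<delta> \<le> (2 * L) powr \<delta> * \<beta> ^ 5"
    proof -
      have "real_of_int N \<le> real_of_int (2 * \<bar>l\<bar> * b ^ 5)"
        using N_le by (simp only: of_int_le_iff)
      then have "real_of_int N powr \<delta> \<le> (2 * L * real_of_int b ^ 5) powr \<delta>"
        using N assms(3) by (intro powr_mono2) (auto simp: L_def)
      also have "\<dots> = (2 * L) powr \<delta> * (real_of_int b ^ 5) powr \<delta>"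
        using L b_pos by (intro powr_mult)
      also have "(real_of_int b ^ 5) powr \<delta> = \<beta> ^ 5"
        using b_pos by (simp add: \<beta>_def powr_powr powr_power mult.commute flip: powr_numeral)
      finally show ?thesis .
    qed
    define u' c' d' V' m' s' N' :: real
      where "u' = u" and "c' = c" and "d' = d" and "V' = V" and "m' = m" and "s' = s" and "N' = N"
    note real_defs = u'_def c'_def d'_def V'_def m'_def s'_def N'_def
    have pos': "u' > 0" "c' > 0" "d' > 0" "V' > 0" "m' > 0" "s' > 0" "N' > 0"
      using pos N by (simp_all add: real_defs)
    have Nm: "N' * m' \<le> L * c' ^ 3 * (s' * u')"
      using Nm_int unfolding real_defs L_def
      by (simp only: of_int_le_iff flip: of_int_mult of_int_power)
    \<comment> \<open>The factor \<open>s' * u'\<close> is split off because it reappears in the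
      bound \<open>Nm\<close> for \<open>N' * m'\<close> and then cancels, which eliminates
      \<open>s'\<close>.\<close>
    have "(s' * u') * (u' ^ 3 * m') = s' * u' ^ 4 * m'"
      by (simp add: eval_nat_numeral)
    also have "\<dots> \<le> (K * L\<^sup>2 * N' powr (1 + \<delta>)) * m'"
      using abc_bound pos' by (intro mult_right_mono) (simp_all add: real_defs)
    also have "\<dots> = (K * L\<^sup>2) * (N' * m') * N' powr \<delta>"
      using pos' by (simp add: powr_add)
    also have "\<dots> \<le> (K * L\<^sup>2) * (L * c' ^ 3 * (s' * u')) * ((2 * L) powr \<delta> * \<beta> ^ 5)"
      using N_powr K L pos' by (intro mult_mono[OF mult_left_mono[OF Nm]]) (auto simp: real_defs)
    also have "\<dots> = (s' * u') * (H * \<beta> ^ 5 * c' ^ 3)"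
      by (simp add: H_def mult_ac)
    finally have um: "u' ^ 3 * m' \<le> H * \<beta> ^ 5 * c' ^ 3"
      using pos' by simp
    have a': "real_of_int a = d' * u'" and b': "real_of_int b = d' * c'"
      by (simp_all add: f(1,2) real_defs)
    have aVm: "(d' * u')\<^sup>2 \<le> 2 * (V' * m')"
    proof -
      have "real_of_int ((d * u)\<^sup>2) \<le> real_of_int (2 * (V * m))"
        using a2l(1)[unfolded f(5)] unfolding f(1) by (simp only: of_int_le_iff)
      then show ?thesis by (simp add: real_defs)
    qed
    have uV': "u'\<^sup>2 * V' \<le> 3 * (d' * c')\<^sup>2"
    proof -
      have "real_of_int (u\<^sup>2 * V) \<le> real_of_int (3 * (d * c)\<^sup>2)"
        using uV unfolding f(2) by (simp only: of_int_le_iff)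
      then show ?thesis by (simp add: real_defs)
    qed
    have "V \<le> c\<^sup>2" using f(4) pos by (intro zdvd_imp_le) auto
    then have Vc: "V' \<le> c'\<^sup>2" unfolding real_defs by (simp only: of_int_le_iff flip: of_int_power)
    \<comment> \<open>The split is chosen so that \<open>u'^8 * V'^2 * m'^2\<close> uses
      \<open>uV'\<close> and \<open>Vc\<close> once each and \<open>um\<close> twice. The powers of
      \<open>d'\<close> and \<open>c'\<close> then both add up to 10, giving
      \<open>b^10\<close>.\<close>
    have "(d' * u') ^ 12 = d' ^ 8 * u' ^ 8 * ((d' * u')\<^sup>2)\<^sup>2"
      by algebra
    also have "\<dots> \<le> d' ^ 8 * u' ^ 8 * (2 * (V' * m'))\<^sup>2"
      using aVm pos' by (intro mult_left_mono power_mono) auto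
    also have "\<dots> = 4 * d' ^ 8 * (u'\<^sup>2 * V') * V' * (u' ^ 3 * m')\<^sup>2"
      by algebra
    also have "\<dots> \<le> 4 * d' ^ 8 * (3 * (d' * c')\<^sup>2) * c'\<^sup>2 * (H * \<beta> ^ 5 * c' ^ 3)\<^sup>2"
      using pos' by (intro mult_mono[OF mult_mono[OF mult_left_mono[OF uV'] Vc] power_mono[OF um]]) auto
    also have "\<dots> = 12 * H\<^sup>2 * ((d' * c') ^ 10 * \<beta> ^ 10)"
      by algebra
    also have "(d' * c') ^ 10 * \<beta> ^ 10 = real_of_int b powr (10 + 10 * \<delta>)"
      using b_pos unfolding b'[symmetric] \<beta>_def
      by (simp add: powr_add powr_power mult.commute)
    finally show "real_of_int a ^ 12 \<le> 12 * H\<^sup>2 * real_of_int b powr (10 + 10 * \<delta>)"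
      by (simp add: a')
  qed
qed

theorem theorem4:
  fixes l :: int and \<epsilon> :: real
  assumes "abc_conjecture"
    and "l \<noteq> 0"
    and "0 < \<epsilon>" and "\<epsilon> < 2 / 5"
  shows "\<exists>c::real. c > 0 \<and>
           (\<forall>a b :: int. 1 \<le> a \<longrightarrow> a < b \<longrightarrow>
              a\<^sup>2 * (a\<^sup>2 + l) dvd b\<^sup>2 * (b\<^sup>2 + l) \<longrightarrow>
              real_of_int b \<ge> c * real_of_int a powr (8 / 7 - \<epsilon>))"
proof -
  obtain M :: real where M: "M > 0"
    and bound: "\<And>a b :: int. 0 < a \<Longrightarrow> a < b \<Longrightarrow> 2 * \<bar>l\<bar> \<le> a\<^sup>2 \<Longrightarrow>
           a\<^sup>2 * (a\<^sup>2 + l) dvd b\<^sup>2 * (b\<^sup>2 + l) \<Longrightarrow>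
           real_of_int a ^ 12 \<le> M * real_of_int b powr (10 + 10 * (1 / 20))"
    using dvd_gap_bound[OF assms(1,2), of "1 / 20"] by auto
  \<comment> \<open>The root \<open>2 / 21\<close> turns \<open>b powr (21 / 2)\<close> into
    \<open>b\<close> and \<open>a ^ 12\<close> into \<open>a powr (8 / 7)\<close>. The second entry
    covers the small \<open>a\<close> with \<open>a^2 < 2 * \<bar>l\<bar>\<close>.\<close>
  define E where "E = max (M powr (2 / 21)) (2 * real_of_int \<bar>l\<bar>)"
  have E: "E > 0" using M by (simp add: E_def less_max_iff_disj)
  show ?thesis
  proof (intro exI[of _ "1 / E"] conjI allI impI)
    show "1 / E > 0" using E by simp
    fix a b :: int
    assume a: "1 \<le> a" and ab: "a < b" and dvd: "a\<^sup>2 * (a\<^sup>2 + l) dvd b\<^sup>2 * (b\<^sup>2 + l)"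
    have "real_of_int a powr (8 / 7) \<le> E * real_of_int b"
    proof (cases "2 * \<bar>l\<bar> \<le> a\<^sup>2")
      case True
      have "real_of_int a powr (8 / 7) = (real_of_int a ^ 12) powr (2 / 21)"
        using a by (simp add: powr_powr flip: powr_numeral)
      also have "\<dots> \<le> (M * real_of_int b powr (21 / 2)) powr (2 / 21)"
        using bound[OF _ ab True dvd] a by (intro powr_mono2) auto
      also have "\<dots> = M powr (2 / 21) * real_of_int b"
        using M a ab by (simp add: powr_mult powr_powr)
      also have "\<dots> \<le> E * real_of_int b"
        using a ab by (intro mult_right_mono) (auto simp: E_def)
      finally show ?thesis .
    next
      case False
      have "real_of_int a powr (8 / 7) \<le> real_of_int a powr 2"
        using a by (intro powr_mono) auto
      also have "\<dots> = real_of_int (a\<^sup>2)" using a by simp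
      also have "\<dots> \<le> real_of_int (2 * \<bar>l\<bar>)" using False by (simp only: of_int_le_iff)
      also have "\<dots> \<le> E" by (simp add: E_def)
      also have "\<dots> \<le> E * real_of_int b" using E a ab by simp
      finally show ?thesis .
    qed
    moreover have "real_of_int a powr (8 / 7 - \<epsilon>) \<le> real_of_int a powr (8 / 7)"
      using a assms(3) by (intro powr_mono) auto
    ultimately show "real_of_int b \<ge> 1 / E * real_of_int a powr (8 / 7 - \<epsilon>)"
      using E by (simp add: field_simps)
  qed
qed

end
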